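(* Let $\mathcal{X}$ be a non-empty set, let $\mathcal{F} \subseteq \mathcal{X}^{\mathcal{X}}$ be any non-empty class of functions, and let $T \in \mathbb{N}$. Then $$\tfrac{1}{2}\,\operatorname{C}_T(\mathcal{F}) \;\leq\; \inf_{\mathcal{A}}\,\operatorname{M}_{\mathcal{A}}(T, \mathcal{F}) \;\leq\; \operatorname{C}_T(\mathcal{F}),$$ where the infimum is over all (possibly randomized) learners. Moreover, the upper bound is achieved by a deterministic learner: there is a deterministic learner $\mathcal{A}$ with $\operatorname{M}_{\mathcal{A}}(T,\mathcal{F}) \le \operatorname{C}_T(\mathcal{F})$.
   Context: $\mathbb{N}=\{1,2,\dots\}$, $[T]=\{1,\dots,T\}$. A learner $\mathcal{A}$ is a (possibly randomized) rule that maps every finite sequence of states $x_{<t} := (x_0,\dots,x_{t-1})$ to a prediction $\mathcal{A}(x_{<t}) \in \mathcal{X}$; it is deterministic if it uses no randomness. It may depend on $T$ and $\mathcal{F}$. Expected number of mistakes in the realizable setting: $$\operatorname{M}_{\mathcal{A}}(T,\mathcal{F}) := \sup_{x_0\in\mathcal{X}}\ \sup_{f\in\mathcal{F}}\ \mathbb{E}\Big[\sum_{t=1}^T \mathbf{1}\{\mathcal{A}(x_{<t}) \neq f(x_{t-1})\}\Big],$$ where $x_t = f(x_{t-1})$ for all $t\in[T]$ and the expectation is over the learner's randomness. Trajectory tree of depth $d$: a sequence $\mathcal{T}=(\mathcal{T}_0,\mathcal{T}_1,\dots,\mathcal{T}_d)$ with $\mathcal{T}_0\in\mathcal{X}$ (the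 root label) and $\mathcal{T}_t:\{-1,1\}^t\to\mathcal{X}$ for $t\in[d]$ (a complete binary tree with nodes labeled by states). For $\sigma\in\{-1,1\}^d$, write $\sigma_{\le t}=(\sigma_1,\dots,\sigma_t)$ and $\sigma_{<t}=(\sigma_1,\dots,\sigma_{t-1})$. The tree $\mathcal{T}$ is shattered by $\mathcal{F}$ if for every $\sigma\in\{-1,1\}^d$ there is $f_\sigma\in\mathcal{F}$ with $f_\sigma(\mathcal{T}_{t-1}(\sigma_{<t}))=\mathcal{T}_t(\sigma_{\le t})$ for all $t\in[d]$. Branching factor: $\operatorname{B}(\mathcal{T}) := \min_{\sigma\in\{-1,1\}^d}\sum_{t=1}^d \mathbf{1}\{\mathcal{T}_t((\sigma_{<t},-1))\neq\mathcal{T}_t((\sigma_{<t},+1))\}$. Evolution complexity at depth $d$: $\operatorname{C}_d(\mathcal{F}) := \sup\{\operatorname{B}(\mathcal{T}) : \mathcal{T}\text{ is a trajectory tree of depth } d \text{ shattered by }\mathcal{F}\}$. *)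

theory Defs
  imports "HOL-Probability.Probability"
begin

text \<open>The state space is the whole type \<open>'x\<close>.\<close>

type_synonym 'x learner = "'x list \<Rightarrow> 'x"

text \<open>\<open>history f x t\<close> is the list \<open>[x\<^sub>0, \<dots>, x\<^sub>t\<^sub>-\<^sub>1]\<close> of the first \<open>t\<close> states
  of the trajectory \<open>x\<^sub>s = f (x\<^sub>s\<^sub>-\<^sub>1)\<close> started in \<open>x\<^sub>0 = x\<close>.\<close>

definition history :: "('x \<Rightarrow> 'x) \<Rightarrow> 'x \<Rightarrow> nat \<Rightarrow> 'x list" where
  "history f x t = map (\<lambda>s. (f ^^ s) x) [0..<t]"

definition mistakes :: "'x learner \<Rightarrow> nat \<Rightarrow> ('x \<Rightarrow> 'x) \<Rightarrow> 'x \<Rightarrow> nat" where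
  "mistakes A T f x = (\<Sum>t=1..T. of_bool (A (history f x t) \<noteq> f ((f ^^ (t - 1)) x)))"

text \<open>A randomized learner is a probability distribution on deterministic learners: the random
  seed is the learner itself. The \<sigma>-algebra is generated by the events
  \<open>A xs = y\<close>, the only ones needed to speak about the expected number of mistakes. Nothing is
  lost by fixing this sample space, see \<open>learner_of_seed\<close> and
  \<open>expected_mistakes_of_seed\<close> below. Predictions on different histories may be arbitrarily
  correlated.\<close>

definition learner_space :: "'x learner measure" where
  "learner_space = sigma UNIV {{A. A xs = y} | xs y. True}"

definition randomized_learners :: "'x learner measure set" where
  "randomized_learners = {P. prob_space P \<and> sets P = sets learner_space}"

definition deterministic :: "'x learner \<Rightarrow> 'x learner measure" where
  "deterministic A = return learner_space A"

definition expected_mistakes :: "'x learner measure \<Rightarrow> nat \<Rightarrow> ('x \<Rightarrow> 'x) set \<Rightarrow> ennreal" where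
  "expected_mistakes P T F = (SUP x. SUP f\<in>F. \<integral>\<^sup>+ A. of_nat (mistakes A T f x) \<partial>P)"

text \<open>A trajectory tree of depth \<open>d\<close> is a labelling of the sign sequences of length at most
  \<open>d\<close> (\<open>False\<close> for -1, \<open>True\<close> for +1); the root is \<open>[]\<close>. Labels of longer
  sequences are never inspected.\<close>

type_synonym 'x tree = "bool list \<Rightarrow> 'x"

definition shattered :: "('x \<Rightarrow> 'x) set \<Rightarrow> nat \<Rightarrow> 'x tree \<Rightarrow> bool" where
  "shattered F d R \<longleftrightarrow>
    (\<forall>\<sigma>. length \<sigma> = d \<longrightarrow>
      (\<exists>f\<in>F. \<forall>t\<in>{1..d}. f (R (take (t - 1) \<sigma>)) = R (take t \<sigma>)))"

definition branching_factor :: "nat \<Rightarrow> 'x tree \<Rightarrow> nat" where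
  "branching_factor d R =
    Min ((\<lambda>\<sigma>. \<Sum>t=1..d. of_bool (R (take (t - 1) \<sigma> @ [False]) \<noteq> R (take (t - 1) \<sigma> @ [True])))
         ` {\<sigma>. length \<sigma> = d})"

definition evolution_complexity :: "nat \<Rightarrow> ('x \<Rightarrow> 'x) set \<Rightarrow> ennreal" where
  "evolution_complexity d F = (SUP R\<in>{R. shattered F d R}. of_nat (branching_factor d R))"

lemma space_learner_space [simp]: "space learner_space = UNIV"
  by (simp add: learner_space_def space_measure_of_conv)

lemma sets_learner_space:
  "sets learner_space = sigma_sets UNIV {{A. A xs = y} | xs y. True}"
  unfolding learner_space_def by (rule sets_measure_of) auto

lemma prediction_event [measurable]: "Measurable.pred learner_space (\<lambda>A. A xs = y)"
  unfolding pred_def by (auto simp: sets_learner_space intro!: sigma_sets.Basic)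

lemma measurable_mistakes [measurable]:
  "(\<lambda>A. mistakes A T f x) \<in> measurable learner_space (count_space UNIV)"
  unfolding mistakes_def by measurable

lemma deterministic_in_randomized_learners: "deterministic A \<in> randomized_learners"
  by (simp add: deterministic_def randomized_learners_def prob_space_return)

lemma expected_mistakes_deterministic:
  "expected_mistakes (deterministic A) T F = (SUP x. SUP f\<in>F. of_nat (mistakes A T f x))"
  by (simp add: expected_mistakes_def deterministic_def nn_integral_return)

text \<open>A prediction rule driven by a seed drawn from an arbitrary probability space induces a
  randomized learner with the same expected number of mistakes.\<close>

lemma measurable_seeded_rule:
  fixes A :: "'a \<Rightarrow> 'b learner"
  assumes "\<And>xs y. Measurable.pred M (\<lambda>\<omega>. A \<omega> xs = y)"
  shows "A \<in> measurable M learner_space"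
  unfolding learner_space_def
proof (rule measurable_measure_of)
  fix E :: "'b learner set" assume "E \<in> {{A. A xs = y} | xs y. True}"
  then obtain xs y where E: "E = {A. A xs = y}" by blast
  have "A -` E \<inter> space M = {\<omega> \<in> space M. A \<omega> xs = y}" using E by auto
  then show "A -` E \<inter> space M \<in> sets M" using assms[of xs y] by (simp add: pred_def)
qed auto

lemma learner_of_seed:
  assumes "prob_space M" "\<And>xs y. Measurable.pred M (\<lambda>\<omega>. A \<omega> xs = y)"
  shows "distr M learner_space A \<in> randomized_learners"
  using prob_space.prob_space_distr[OF assms(1) measurable_seeded_rule[OF assms(2)]]
  by (simp add: randomized_learners_def)

lemma expected_mistakes_of_seed:
  fixes A :: "'a \<Rightarrow> 'b learner"
  assumes "\<And>xs y. Measurable.pred M (\<lambda>\<omega>. A \<omega> xs = y)"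
  shows "expected_mistakes (distr M learner_space A) T F =
    (SUP x. SUP f\<in>F. \<integral>\<^sup>+ \<omega>. of_nat (mistakes (A \<omega>) T f x) \<partial>M)"
  by (simp add: expected_mistakes_def nn_integral_distr[OF measurable_seeded_rule[OF assms]])

end

theory Submission
  imports Defs
begin

text \<open>Upper bound: the learner keeps the version space of all functions consistent with the
  history and predicts the next state whose restricted version space still admits, at the
  remaining depth, a shattered tree of the largest branching factor. Whenever it errs, the actual
  and the predicted state are the two distinct children of a node below both of which the
  remaining value is available, so the number of mistakes is the branching factor of some
  shattered tree.

  Lower bound: let the adversary follow a uniformly random branch of a shattered tree. At a
  node with distinct children the learner errs with probability at least one half, which is seen
  by pairing each branch with the one whose sign is flipped at that node.\<close>

section \<open>Sign sequences and bounds on the branching factor\<close>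

abbreviation branches :: "'x tree \<Rightarrow> bool list \<Rightarrow> bool" where
  "branches R \<tau> \<equiv> R (\<tau> @ [False]) \<noteq> R (\<tau> @ [True])"

lemma finite_signs: "finite {\<sigma> :: bool list. length \<sigma> = d}"
  using finite_lists_length_eq[of "UNIV :: bool set" d] by simp

lemma card_signs: "card {\<sigma> :: bool list. length \<sigma> = d} = 2 ^ d"
  using card_lists_length_eq[of "UNIV :: bool set" d] by simp

lemma branching_factor_le:
  assumes "length \<sigma> = d"
  shows "branching_factor d R \<le> (\<Sum>t=1..d. of_bool (branches R (take (t - 1) \<sigma>)))"
  unfolding branching_factor_def using assms by (intro Min_le finite_imageI finite_signs) auto

lemma le_branching_factorI:
  assumes "\<And>\<sigma>. length \<sigma> = d \<Longrightarrow> k \<le> (\<Sum>t=1..d. of_bool (branches R (take (t - 1) \<sigma>)))"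
  shows "k \<le> branching_factor d R"
proof -
  have "{\<sigma> :: bool list. length \<sigma> = d} \<noteq> {}"
    using card_signs[of d] by (metis card.empty power_not_zero zero_neq_numeral)
  then show ?thesis
    unfolding branching_factor_def using assms finite_signs[of d] by (subst Min_ge_iff) auto
qed

lemma branching_factor_le_depth: "branching_factor d R \<le> d"
proof -
  have "branching_factor d R \<le> (\<Sum>t=1..d. of_bool (branches R (take (t - 1) (replicate d True))))"
    by (rule branching_factor_le) simp
  also have "\<dots> \<le> (\<Sum>t=1..d. 1)" by (intro sum_mono) simp
  finally show ?thesis by simp
qed

subsection \<open>The version space learner\<close>

text \<open>With \<open>\<le>\<close> instead of equality the attained values are downward closed.
  Nothing, not even 0, is attained when \<open>V\<close> is empty.\<close>

definition attains :: "nat \<Rightarrow> ('x \<Rightarrow> 'x) set \<Rightarrow> 'x \<Rightarrow> nat \<Rightarrow> bool" where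
  "attains d V x k \<longleftrightarrow> (\<exists>R. R [] = x \<and> shattered V d R \<and> k \<le> branching_factor d R)"

definition value_rank :: "nat \<Rightarrow> ('x \<Rightarrow> 'x) set \<Rightarrow> 'x \<Rightarrow> nat" where
  "value_rank d V x = (GREATEST k. attains d V x k)"

text \<open>This bound yields a greatest attained value as soon as one is attained; otherwise
  \<open>value_rank\<close> is unspecified.\<close>

lemma attains_le_depth: "attains d V x k \<Longrightarrow> k \<le> d"
  unfolding attains_def using branching_factor_le_depth le_trans by blast

lemma attains_mono: "attains d V x k \<Longrightarrow> j \<le> k \<Longrightarrow> attains d V x j"
  unfolding attains_def using le_trans by blast

lemma le_rank: "attains d V x k \<Longrightarrow> k \<le> value_rank d V x"
  unfolding value_rank_def using attains_le_depth Greatest_le_nat by metis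

lemma attains_rank: "attains d V x k \<Longrightarrow> attains d V x (value_rank d V x)"
  unfolding value_rank_def using attains_le_depth GreatestI_nat by metis

lemma attains_depth_0: "V \<noteq> {} \<Longrightarrow> attains 0 V x 0"
  unfolding attains_def shattered_def by auto

text \<open>The case \<open>y = z\<close>, a node without branching, serves the rounds predicted correctly.\<close>

lemma attains_join:
  assumes "attains d {f \<in> V. f x = y} y k" "attains d {f \<in> V. f x = z} z k"
  shows "attains (Suc d) V x (of_bool (y \<noteq> z) + k)"
proof -
  obtain Q where Q: "Q [] = y" "shattered {f \<in> V. f x = y} d Q" "k \<le> branching_factor d Q"
    using assms(1) unfolding attains_def by blast
  obtain R where R: "R [] = z" "shattered {f \<in> V. f x = z} d R" "k \<le> branching_factor d R"
    using assms(2) unfolding attains_def by blast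
  \<comment> \<open>The two trees are glued below a new root \<open>x\<close>: \<open>Q\<close> at
    sign -1, \<open>R\<close> at sign +1.\<close>
  define S where "S \<sigma> = (case \<sigma> of [] \<Rightarrow> x | b # \<tau> \<Rightarrow> if b then R \<tau> else Q \<tau>)" for \<sigma>
  have S_simps: "S [] = x" "\<And>b \<tau>. S (b # \<tau>) = (if b then R else Q) \<tau>"
    by (simp_all add: S_def)
  have "shattered V (Suc d) S"
    unfolding shattered_def
  proof (intro allI impI)
    fix \<sigma> :: "bool list" assume "length \<sigma> = Suc d"
    then obtain b \<tau> where \<sigma>: "\<sigma> = b # \<tau>" "length \<tau> = d" by (cases \<sigma>) auto
    \<comment> \<open>The witness for \<open>\<tau>\<close> in the chosen subtree lies in the class
      restricted at \<open>x\<close>, which supplies the edge leaving the root.\<close>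
    obtain f where f: "f \<in> V" "f x = (if b then R else Q) []"
      "\<And>t. t \<in> {1..d} \<Longrightarrow> f ((if b then R else Q) (take (t - 1) \<tau>)) = (if b then R else Q) (take t \<tau>)"
    proof (cases b)
      case True
      then show ?thesis using that R(1) R(2)[unfolded shattered_def, rule_format, OF \<sigma>(2)] by auto
    next
      case False
      then show ?thesis using that Q(1) Q(2)[unfolded shattered_def, rule_format, OF \<sigma>(2)] by auto
    qed
    have "f (S (take (t - 1) \<sigma>)) = S (take t \<sigma>)" if "t \<in> {1..Suc d}" for t
    proof -
      obtain s where t: "t = Suc s" "s \<le> d" using \<open>t \<in> {1..Suc d}\<close> by (cases t) auto
      show ?thesis
      proof (cases s)
        case 0
        then show ?thesis using f(2) t by (simp add: \<sigma>(1) S_simps)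
      next
        case (Suc r)
        then show ?thesis using f(3)[of s] t by (simp add: \<sigma>(1) S_simps)
      qed
    qed
    then show "\<exists>f\<in>V. \<forall>t\<in>{1..Suc d}. f (S (take (t - 1) \<sigma>)) = S (take t \<sigma>)"
      using f(1) by blast
  qed
  moreover have "of_bool (y \<noteq> z) + k \<le> branching_factor (Suc d) S"
  proof (rule le_branching_factorI)
    fix \<sigma> :: "bool list" assume "length \<sigma> = Suc d"
    then obtain b \<tau> where \<sigma>: "\<sigma> = b # \<tau>" "length \<tau> = d" by (cases \<sigma>) auto
    \<comment> \<open>Below the root every branch runs inside one of the two subtrees, each worth at
      least \<open>k\<close>.\<close>
    have "k \<le> branching_factor d (if b then R else Q)" using Q(3) R(3) by simp
    also have "\<dots> \<le> (\<Sum>t=1..d. of_bool (branches (if b then R else Q) (take (t - 1) \<tau>)))"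
      using \<sigma>(2) by (rule branching_factor_le)
    also have "\<dots> = (\<Sum>t=1..d. of_bool (branches S (take t \<sigma>)))"
    proof (rule sum.cong)
      fix t assume "t \<in> {1..d}"
      then obtain s where "t = Suc s" by (cases t) auto
      then show "of_bool (branches (if b then R else Q) (take (t - 1) \<tau>))
        = (of_bool (branches S (take t \<sigma>)) :: nat)"
        by (simp add: \<sigma>(1) S_simps)
    qed simp
    finally have "k \<le> (\<Sum>t=1..d. of_bool (branches S (take t \<sigma>)))" .
    moreover have "(\<Sum>t=1..Suc d. of_bool (branches S (take (t - 1) \<sigma>)))
      = of_bool (branches S []) + (\<Sum>t=1..d. of_bool (branches S (take t \<sigma>)) :: nat)"
      by (subst sum.atLeast_Suc_atMost)
        (simp_all only: sum.atLeast_Suc_atMost_Suc_shift o_def One_nat_def Suc_le_mono le0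
          diff_Suc_Suc minus_nat.diff_0 take_0)
    moreover have "branches S [] \<longleftrightarrow> y \<noteq> z" by (simp add: S_simps Q(1) R(1))
    ultimately show "of_bool (y \<noteq> z) + k
      \<le> (\<Sum>t=1..Suc d. of_bool (branches S (take (t - 1) \<sigma>)))" by simp
  qed
  ultimately show ?thesis unfolding attains_def using S_simps(1) by blast
qed

section \<open>The learner and its mistakes\<close>

definition version_space :: "('x \<Rightarrow> 'x) set \<Rightarrow> 'x list \<Rightarrow> ('x \<Rightarrow> 'x) set" where
  "version_space F h = {g \<in> F. \<forall>i. Suc i < length h \<longrightarrow> g (h ! i) = h ! Suc i}"

text \<open>The predicted state is a child of the current node, with \<open>T - length h\<close>
  levels below it. Candidates without an attained value are excluded, as their rank is
  meaningless.\<close>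

definition rank_learner :: "nat \<Rightarrow> ('x \<Rightarrow> 'x) set \<Rightarrow> 'x learner" where
  "rank_learner T F h =
    (let V = version_space F h; x = last h; d = T - length h
     in arg_max (\<lambda>y. value_rank d {g \<in> V. g x = y} y) (\<lambda>y. \<exists>k. attains d {g \<in> V. g x = y} y k))"

lemma length_history [simp]: "length (history f x t) = t"
  by (simp add: history_def)

lemma history_Suc: "history f x (Suc t) = history f x t @ [(f ^^ t) x]"
  by (simp add: history_def)

lemma nth_history: "i < t \<Longrightarrow> history f x t ! i = (f ^^ i) x"
  by (simp add: history_def)

lemma version_space_history:
  "version_space F (history f x t)
    = {g \<in> F. \<forall>i. Suc i < t \<longrightarrow> g ((f ^^ i) x) = (f ^^ Suc i) x}"
  unfolding version_space_def
  by (rule Collect_cong) (auto simp: nth_history simp del: funpow.simps)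

text \<open>The restriction by a candidate state thus becomes the next version space once that state
  is observed.\<close>

lemma version_space_history_Suc:
  "version_space F (history f x (Suc (Suc t)))
    = {g \<in> version_space F (history f x (Suc t)). g ((f ^^ t) x) = (f ^^ Suc t) x}"
  unfolding version_space_history by (auto simp: less_Suc_eq simp del: funpow.simps)

text \<open>The prediction has maximal rank, so by downward closure it attains whatever any
  candidate attains, the actual next state included.\<close>

lemma rank_learner_attains:
  assumes "attains (T - length h) {g \<in> version_space F h. g (last h) = y} y k"
  defines "z \<equiv> rank_learner T F h"
  shows "attains (T - length h) {g \<in> version_space F h. g (last h) = z} z k"
proof -
  let ?d = "T - length h" and ?V = "\<lambda>y. {g \<in> version_space F h. g (last h) = y}"
  \<comment> \<open>Ranks bounded by the remaining depth guarantee that the maximum in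
    \<open>arg_max\<close> is reached.\<close>
  have bound: "\<forall>y. (\<exists>k. attains ?d (?V y) y k) \<longrightarrow> value_rank ?d (?V y) y < Suc ?d"
    using attains_rank attains_le_depth by (metis le_imp_less_Suc)
  have "\<exists>k. attains ?d (?V y) y k" using assms(1) by blast
  from arg_max_nat_lemma[of "\<lambda>y. \<exists>k. attains ?d (?V y) y k", OF this bound]
  have ex: "\<exists>k. attains ?d (?V z) z k" and le: "value_rank ?d (?V y) y \<le> value_rank ?d (?V z) z"
    using assms(1) unfolding z_def rank_learner_def Let_def by blast+
  from ex obtain j where "attains ?d (?V z) z j" ..
  from attains_mono[OF attains_rank[OF this] order.trans[OF le_rank[OF assms(1)] le]]
  show ?thesis .
qed

text \<open>Induction on the number \<open>d\<close> of rounds left, with \<open>t\<close> varying: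
  each round adds a root above the tree built for the later rounds.\<close>

lemma attains_mistakes_suffix:
  assumes "f \<in> F"
  shows "t + d = T \<Longrightarrow> attains d (version_space F (history f x (Suc t))) ((f ^^ t) x)
    (\<Sum>s=Suc t..T. of_bool (rank_learner T F (history f x s) \<noteq> f ((f ^^ (s - 1)) x)))"
proof (induction d arbitrary: t)
  case 0
  \<comment> \<open>\<open>f\<close> itself is consistent with its own history.\<close>
  have "version_space F (history f x (Suc t)) \<noteq> {}"
    using assms by (auto simp: version_space_history)
  then show ?case using 0 by (simp add: attains_depth_0)
next
  case (Suc d)
  let ?h = "history f x (Suc t)" and ?x = "(f ^^ t) x"
  define k :: nat where
    "k = (\<Sum>s=Suc (Suc t)..T. of_bool (rank_learner T F (history f x s) \<noteq> f ((f ^^ (s - 1)) x)))"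
  have d: "T - length ?h = d" and x: "last ?h = ?x"
    using Suc.prems by (auto simp: history_Suc)
  have k: "attains d {g \<in> version_space F ?h. g ?x = f ?x} (f ?x) k"
    using Suc.IH[of "Suc t"] Suc.prems by (simp add: version_space_history_Suc k_def)
  \<comment> \<open>The actual child attains \<open>k\<close> by induction, the predicted child by
    maximality; a mistake means that they differ.\<close>
  have "attains (Suc d) (version_space F ?h) ?x (of_bool (rank_learner T F ?h \<noteq> f ?x) + k)"
    using attains_join rank_learner_attains[of T ?h, unfolded d x, OF k] k .
  moreover have "(\<Sum>s=Suc t..T. of_bool (rank_learner T F (history f x s) \<noteq> f ((f ^^ (s - 1)) x)))
    = of_bool (rank_learner T F ?h \<noteq> f ?x) + k"
    unfolding k_def using Suc.prems by (subst sum.atLeast_Suc_atMost) simp_all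
  ultimately show ?case by simp
qed

lemma attains_mistakes:
  assumes "f \<in> F"
  shows "attains T F x (mistakes (rank_learner T F) T f x)"
  \<comment> \<open>A single state records no transition, so the initial version space is all of
    \<open>F\<close>.\<close>
  using attains_mistakes_suffix[OF assms, of 0 T T x]
  by (simp add: mistakes_def version_space_history)

lemma attains_le_evolution_complexity:
  assumes "attains d F x k"
  shows "of_nat k \<le> evolution_complexity d F"
proof -
  obtain R where "shattered F d R" "k \<le> branching_factor d R"
    using assms unfolding attains_def by blast
  then show ?thesis
    unfolding evolution_complexity_def by (intro SUP_upper2[of R]) auto
qed

lemma rank_learner_expected_mistakes:
  "expected_mistakes (deterministic (rank_learner T F)) T F \<le> evolution_complexity T F"
  unfolding expected_mistakes_deterministic
  by (intro SUP_least attains_le_evolution_complexity[OF attains_mistakes])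

subsection \<open>The random branch adversary\<close>

text \<open>Flipping one sign is an involution on the sequences of length \<open>d\<close>.\<close>

lemma sum_flip_sign:
  fixes u :: "bool list \<Rightarrow> nat"
  assumes "i < d"
  shows "(\<Sum>\<sigma> | length \<sigma> = d. u (\<sigma>[i := \<not> \<sigma> ! i])) = (\<Sum>\<sigma> | length \<sigma> = d. u \<sigma>)"
  by (rule sum.reindex_bij_witness[where i = "\<lambda>\<sigma>. \<sigma>[i := \<not> \<sigma> ! i]" and j = "\<lambda>\<sigma>. \<sigma>[i := \<not> \<sigma> ! i]"])
    (use assms in auto)

lemma funpow_along_branch:
  assumes "\<And>t. t \<in> {1..d} \<Longrightarrow> f (R (take (t - 1) \<sigma>)) = R (take t \<sigma>)"
  shows "t \<le> d \<Longrightarrow> (f ^^ t) (R []) = R (take t \<sigma>)"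
proof (induction t)
  case (Suc t)
  then show ?case using assms[of "Suc t"] by simp
qed simp

text \<open>The right side mentions labels only, so branches with different witnesses
  \<open>f\<close> become comparable.\<close>

lemma mistakes_along_branch:
  assumes "\<And>t. t \<in> {1..d} \<Longrightarrow> f (R (take (t - 1) \<sigma>)) = R (take t \<sigma>)"
  shows "mistakes A d f (R [])
    = (\<Sum>t=1..d. of_bool (A (map (\<lambda>s. R (take s \<sigma>)) [0..<t]) \<noteq> R (take t \<sigma>)))"
  unfolding mistakes_def
proof (rule sum.cong)
  fix t assume t: "t \<in> {1..d}"
  have "history f (R []) t = map (\<lambda>s. R (take s \<sigma>)) [0..<t]"
    using t by (auto simp: history_def intro!: funpow_along_branch assms)
  moreover have "f ((f ^^ (t - 1)) (R [])) = R (take t \<sigma>)"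
    using t funpow_along_branch[of d f R \<sigma> "t - 1", OF assms] assms[of t] by fastforce
  ultimately show "of_bool (A (history f (R []) t) \<noteq> f ((f ^^ (t - 1)) (R [])))
    = (of_bool (A (map (\<lambda>s. R (take s \<sigma>)) [0..<t]) \<noteq> R (take t \<sigma>)) :: nat)" by simp
qed simp

lemma sum_mistakes_at_level:
  fixes A :: "'x learner"
  assumes "t \<in> {1..d}"
  shows "(\<Sum>\<sigma> | length \<sigma> = d. of_bool (branches R (take (t - 1) \<sigma>)))
    \<le> 2 * (\<Sum>\<sigma> | length \<sigma> = d. of_bool (A (map (\<lambda>s. R (take s \<sigma>)) [0..<t]) \<noteq> R (take t \<sigma>)) :: nat)"
proof -
  define i where "i = t - 1"
  define h where "h \<sigma> = map (\<lambda>s. R (take s \<sigma>)) [0..<t]" for \<sigma>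
  define u :: "bool list \<Rightarrow> nat" where "u \<sigma> = of_bool (A (h \<sigma>) \<noteq> R (take t \<sigma>))" for \<sigma>
  have t: "t = Suc i" "i < d" using assms by (auto simp: i_def)
  have "of_bool (branches R (take (t - 1) \<sigma>)) \<le> u \<sigma> + u (\<sigma>[i := \<not> \<sigma> ! i])"
    if "length \<sigma> = d" for \<sigma>
  proof -
    \<comment> \<open>The labels read before round \<open>t\<close> belong to prefixes of length at
      most \<open>i\<close>, which omit entry \<open>i\<close>.\<close>
    have "h (\<sigma>[i := \<not> \<sigma> ! i]) = h \<sigma>" using t by (simp add: h_def)
    moreover have "take t \<sigma> = take i \<sigma> @ [\<sigma> ! i]"
      "take t (\<sigma>[i := \<not> \<sigma> ! i]) = take i \<sigma> @ [\<not> \<sigma> ! i]"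
      using that t by (simp_all add: take_Suc_conv_app_nth)
    \<comment> \<open>Both branches meet the same prediction, which equals at most one of two
      distinct children.\<close>
    ultimately show ?thesis using t by (cases "\<sigma> ! i") (auto simp: u_def)
  qed
  then have "(\<Sum>\<sigma> | length \<sigma> = d. of_bool (branches R (take (t - 1) \<sigma>)))
    \<le> (\<Sum>\<sigma> | length \<sigma> = d. u \<sigma> + u (\<sigma>[i := \<not> \<sigma> ! i]))"
    by (intro sum_mono) simp
  also have "\<dots> = 2 * (\<Sum>\<sigma> | length \<sigma> = d. u \<sigma>)"
    using t(2) by (simp add: sum.distrib sum_flip_sign)
  finally show ?thesis by (simp add: u_def h_def)
qed

text \<open>The average over branches is kept as a sum scaled by \<open>2 ^ d\<close>, which stays
  within the naturals.\<close>

lemma branching_factor_le_sum_mistakes: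
  assumes "\<And>\<sigma> t. length \<sigma> = d \<Longrightarrow> t \<in> {1..d} \<Longrightarrow> f \<sigma> (R (take (t - 1) \<sigma>)) = R (take t \<sigma>)"
  shows "2 ^ d * branching_factor d R
    \<le> 2 * (\<Sum>\<sigma> | length \<sigma> = d. mistakes A d (f \<sigma>) (R []))"
proof -
  have "2 ^ d * branching_factor d R = (\<Sum>\<sigma> | length (\<sigma> :: bool list) = d. branching_factor d R)"
    by (simp add: card_signs)
  also have "\<dots> \<le> (\<Sum>\<sigma> | length \<sigma> = d. \<Sum>t=1..d. of_bool (branches R (take (t - 1) \<sigma>)))"
    by (intro sum_mono branching_factor_le) simp
  \<comment> \<open>Exchanging the sums fixes the round, so that the pairing of branches applies
    level by level.\<close>
  also have "\<dots> = (\<Sum>t=1..d. \<Sum>\<sigma> | length \<sigma> = d. of_bool (branches R (take (t - 1) \<sigma>)))"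
    by (rule sum.swap)
  also have "\<dots> \<le> (\<Sum>t=1..d. 2 * (\<Sum>\<sigma> | length \<sigma> = d.
      of_bool (A (map (\<lambda>s. R (take s \<sigma>)) [0..<t]) \<noteq> R (take t \<sigma>))))"
    by (intro sum_mono sum_mistakes_at_level)
  also have "\<dots> = 2 * (\<Sum>\<sigma> | length \<sigma> = d. \<Sum>t=1..d.
      of_bool (A (map (\<lambda>s. R (take s \<sigma>)) [0..<t]) \<noteq> R (take t \<sigma>)))"
    unfolding sum_distrib_left[symmetric] by (subst sum.swap) simp
  also have "\<dots> = 2 * (\<Sum>\<sigma> | length \<sigma> = d. mistakes A d (f \<sigma>) (R []))"
    by (intro arg_cong[where f = "(*) 2"] sum.cong refl mistakes_along_branch[symmetric] assms) simp
  finally show ?thesis .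
qed

text \<open>The bound holds for every fixed learner, so it survives integration against
  \<open>P\<close>, however the predictions are correlated.\<close>

lemma branching_factor_le_expected_mistakes:
  assumes P: "P \<in> randomized_learners" and R: "shattered F d R"
  shows "of_nat (branching_factor d R) \<le> 2 * expected_mistakes P d F"
proof -
  interpret prob_space P using P by (simp add: randomized_learners_def)
  have sets_P: "sets P = sets learner_space" using P by (simp add: randomized_learners_def)
  have meas: "(\<lambda>A. mistakes A d g x) \<in> measurable P (count_space UNIV)" for g x
    unfolding measurable_cong_sets[OF sets_P refl] by (rule measurable_mistakes)
  have [measurable]: "(\<lambda>A. of_nat (mistakes A d g x) :: ennreal) \<in> borel_measurable P" for g x
    using meas by measurable
  obtain f where f: "\<And>\<sigma>. length \<sigma> = d \<Longrightarrow> f \<sigma> \<in> F"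
    "\<And>\<sigma> t. length \<sigma> = d \<Longrightarrow> t \<in> {1..d} \<Longrightarrow> f \<sigma> (R (take (t - 1) \<sigma>)) = R (take t \<sigma>)"
    using R unfolding shattered_def by metis
  have "(2 ^ d :: ennreal) * of_nat (branching_factor d R)
    = (\<integral>\<^sup>+ A. of_nat (2 ^ d * branching_factor d R) \<partial>P)"
    by (simp add: emeasure_space_1)
  also have "\<dots> \<le> (\<integral>\<^sup>+ A. of_nat (2 * (\<Sum>\<sigma> | length \<sigma> = d. mistakes A d (f \<sigma>) (R []))) \<partial>P)"
    by (intro nn_integral_mono of_nat_mono branching_factor_le_sum_mistakes f(2))
  also have "\<dots> = 2 * (\<Sum>\<sigma> | length \<sigma> = d. \<integral>\<^sup>+ A. of_nat (mistakes A d (f \<sigma>) (R [])) \<partial>P)"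
    by (simp add: nn_integral_cmult nn_integral_sum)
  \<comment> \<open>Every branch starts at \<open>R []\<close> and has its witness in
    \<open>F\<close>, so each integral is below the supremum.\<close>
  also have "\<dots> \<le> 2 * (\<Sum>\<sigma> | length (\<sigma> :: bool list) = d. expected_mistakes P d F)"
    unfolding expected_mistakes_def
    by (intro mult_left_mono sum_mono SUP_upper2[of "R []"] SUP_upper f(1)) auto
  also have "\<dots> = 2 ^ d * (2 * expected_mistakes P d F)"
    by (simp add: card_signs mult.left_commute)
  \<comment> \<open>The factor \<open>2 ^ d\<close> cancels, being neither zero nor
    infinite.\<close>
  finally show ?thesis by (subst (asm) ennreal_mult_le_mult_iff) (auto simp: power_eq_top_ennreal)
qed

lemma evolution_complexity_le_expected_mistakes:
  assumes "P \<in> randomized_learners"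
  shows "(1 / 2) * evolution_complexity d F \<le> expected_mistakes P d F"
proof -
  have "evolution_complexity d F \<le> 2 * expected_mistakes P d F"
    unfolding evolution_complexity_def
    using branching_factor_le_expected_mistakes[OF assms] by (auto intro!: SUP_least)
  then have "(1 / 2) * evolution_complexity d F \<le> (1 / 2) * (2 * expected_mistakes P d F)"
    by (rule mult_left_mono) simp
  also have "\<dots> = expected_mistakes P d F"
    by (simp add: mult.assoc[symmetric] ennreal_divide_times)
  finally show ?thesis .
qed

theorem theorem9:
  fixes F :: "('x \<Rightarrow> 'x) set" and T :: nat
  assumes "F \<noteq> {}" and "1 \<le> T"
  shows "(1 / 2) * evolution_complexity T F \<le> (INF P\<in>randomized_learners. expected_mistakes P T F)
    \<and> (INF P\<in>randomized_learners. expected_mistakes P T F) \<le> evolution_complexity T F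
    \<and> (\<exists>A :: 'x learner. expected_mistakes (deterministic A) T F \<le> evolution_complexity T F)"
proof (intro conjI)
  show "(1 / 2) * evolution_complexity T F \<le> (INF P\<in>randomized_learners. expected_mistakes P T F)"
    by (intro INF_greatest evolution_complexity_le_expected_mistakes)
  show "(INF P\<in>randomized_learners. expected_mistakes P T F) \<le> evolution_complexity T F"
    by (rule INF_lower2[where i = "deterministic (rank_learner T F)"])
      (simp_all add: deterministic_in_randomized_learners rank_learner_expected_mistakes)
  show "\<exists>A :: 'x learner. expected_mistakes (deterministic A) T F \<le> evolution_complexity T F"
    using rank_learner_expected_mistakes by blast
qed

end
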